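(* Let $G=P_2\square P_m$ be the ladder graph on $2m$ vertices, let $\mathcal A(G)$ denote the set of (primitive) arithmetical structures on $G$, and define $N(m)=|\mathcal A(G)|$. Then $C_{m-1}\le N(m)$, where $C_{m-1}$ is the $(m-1)$-th Catalan number.
   Context: An arithmetical structure on a finite connected graph $G$ is a pair $(\mathbf d,\mathbf r)$ of vectors of positive integers indexed by the vertices of $G$ such that $\mathbf r$ is primitive (the gcd of its entries is $1$) and $(\operatorname{diag}(\mathbf d)-A(G))\mathbf r=0$, where $A(G)$ is the adjacency matrix of $G$. $P_n$ is the path graph with vertex set $\{1,\dots,n\}$ and edges $\{i,i+1\}$, $1\le i<n$. The Cartesian product $G_1\square G_2$ has vertex set $V(G_1)\times V(G_2)$, with $(u_1,v_1)$ adjacent to $(u_2,v_2)$ iff ($u_1=u_2$ and $v_1v_2\in E(G_2)$) or ($v_1=v_2$ and $u_1u_2\in E(G_1)$). The Catalan numbers are $C_n=\frac{1}{n+1}\binom{2n}{n}$. *)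

theory Defs
  imports Complex_Main "HOL-Library.FuncSet" "Graph_Theory.Graph_Theory"
begin

text \<open>
  As usual in \<open>Graph_Theory\<close>, a finite simple graph is a symmetric loop-free digraph
  (locale \<^locale>\<open>pair_graph\<close>): an edge \<open>{u, v}\<close> is the pair of arcs \<open>(u, v)\<close>, \<open>(v, u)\<close>.
\<close>

definition path_graph :: "nat \<Rightarrow> nat pair_pre_digraph" where
  "path_graph n = \<lparr> pverts = {1..n}, parcs = (\<Union>i\<in>{1..<n}. {(i, i + 1), (i + 1, i)}) \<rparr>"

definition cartesian_product ::
    "'a pair_pre_digraph \<Rightarrow> 'b pair_pre_digraph \<Rightarrow> ('a \<times> 'b) pair_pre_digraph"
    (infixl "\<box>" 70) where
  "G \<box> H = \<lparr> pverts = pverts G \<times> pverts H,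
     parcs = {((u\<^sub>1, v\<^sub>1), (u\<^sub>2, v\<^sub>2)) | u\<^sub>1 v\<^sub>1 u\<^sub>2 v\<^sub>2.
       (u\<^sub>1, v\<^sub>1) \<in> pverts G \<times> pverts H \<and> (u\<^sub>2, v\<^sub>2) \<in> pverts G \<times> pverts H \<and>
       (u\<^sub>1 = u\<^sub>2 \<and> (v\<^sub>1, v\<^sub>2) \<in> parcs H \<or> v\<^sub>1 = v\<^sub>2 \<and> (u\<^sub>1, u\<^sub>2) \<in> parcs G)} \<rparr>"

text \<open>
  Matrices and vectors are indexed by the vertices themselves. A vector is a function that is
  extensional on the vertex set, so that two vectors are equal iff their entries agree and sets of
  vectors can be counted.
\<close>

definition adjacency_matrix :: "'a pair_pre_digraph \<Rightarrow> 'a \<Rightarrow> 'a \<Rightarrow> int" where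
  "adjacency_matrix G u v = (if (u, v) \<in> parcs G then 1 else 0)"

definition diagonal_matrix :: "('a \<Rightarrow> int) \<Rightarrow> 'a \<Rightarrow> 'a \<Rightarrow> int" where
  "diagonal_matrix d u v = (if u = v then d u else 0)"

definition arithmetical_structure ::
    "'a pair_pre_digraph \<Rightarrow> ('a \<Rightarrow> int) \<Rightarrow> ('a \<Rightarrow> int) \<Rightarrow> bool" where
  "arithmetical_structure G d r \<longleftrightarrow>
     d \<in> pverts G \<rightarrow>\<^sub>E {0<..} \<and> r \<in> pverts G \<rightarrow>\<^sub>E {0<..} \<and>
     Gcd (r ` pverts G) = 1 \<and>
     (\<forall>u\<in>pverts G.
        (\<Sum>v\<in>pverts G. (diagonal_matrix d u v - adjacency_matrix G u v) * r v) = 0)"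

definition arithmetical_structures ::
    "'a pair_pre_digraph \<Rightarrow> (('a \<Rightarrow> int) \<times> ('a \<Rightarrow> int)) set" where
  "arithmetical_structures G = {(d, r). arithmetical_structure G d r}"

text \<open>The division is exact, see \<open>real_catalan\<close> below.\<close>

definition catalan :: "nat \<Rightarrow> nat" where
  "catalan n = ((2 * n) choose n) div (n + 1)"

lemma real_catalan: "real (catalan n) = 1 / (real n + 1) * real ((2 * n) choose n)"
proof -
  have "(n + 1) * ((2 * n) choose (n + 1)) = n * ((2 * n) choose n)"
    by (cases n) (use Suc_times_binomial_add[of n "n - 1"] in \<open>simp_all add: mult_2\<close>)
  hence "int ((n + 1) * ((2 * n) choose (n + 1))) = int (n * ((2 * n) choose n))"
    by (simp only:)
  hence "int ((2 * n) choose n)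
      = int (n + 1) * (int ((2 * n) choose n) - int ((2 * n) choose (n + 1)))"
    by (simp only: of_nat_mult of_nat_add of_nat_1) algebra
  hence "int (n + 1) dvd int ((2 * n) choose n)"
    by (metis dvd_triv_left)
  hence "(n + 1) dvd ((2 * n) choose n)"
    by (simp only: int_dvd_int_iff)
  thus ?thesis
    by (simp add: catalan_def real_of_nat_div add.commute)
qed

lemma pair_graph_path_graph: "pair_graph (path_graph n)"
  by unfold_locales (auto simp: path_graph_def symmetric_def sym_def arcs_ends_def
      arc_to_ends_def with_proj_def image_iff)

lemma pair_graph_cartesian_product:
  assumes "pair_graph G" "pair_graph H"
  shows "pair_graph (G \<box> H)"
proof -
  interpret G: pair_graph G by fact
  interpret H: pair_graph H by fact
  have sG: "(u, v) \<in> parcs G \<Longrightarrow> (v, u) \<in> parcs G" for u v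
    using G.sym_arcs by (auto simp: symmetric_def dest: symD)
  have sH: "(u, v) \<in> parcs H \<Longrightarrow> (v, u) \<in> parcs H" for u v
    using H.sym_arcs by (auto simp: symmetric_def dest: symD)
  have "parcs (G \<box> H) \<subseteq> (pverts G \<times> pverts H) \<times> (pverts G \<times> pverts H)"
    by (auto simp: cartesian_product_def)
  hence "finite (parcs (G \<box> H))"
    by (rule finite_subset) auto
  thus ?thesis
    by unfold_locales
      (auto simp: cartesian_product_def symmetric_def sym_def arcs_ends_def arc_to_ends_def
        with_proj_def image_iff dest: sG sH G.pair_no_loops H.pair_no_loops)
qed

lemma connected_ladder:
  assumes "m \<ge> 1"
  shows "connected (with_proj (path_graph 2 \<box> path_graph m))"
proof -
  let ?G = "path_graph 2 \<box> path_graph m"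
  interpret pair_graph ?G
    by (intro pair_graph_cartesian_product pair_graph_path_graph)
  have V: "pverts ?G = {1..2} \<times> {1..m}"
    by (simp add: cartesian_product_def path_graph_def)
  have root: "reachable (with_proj ?G) (1, 1) (1, j)" if "j \<ge> 1" "j \<le> m" for j
    using that
  proof (induction j rule: dec_induct)
    case base
    show ?case using assms V by (intro reachable_refl) auto
  next
    case (step j)
    have "((1, j), (1, Suc j)) \<in> parcs ?G"
      using step by (auto simp: cartesian_product_def path_graph_def)
    thus ?case using step by (intro reachable_adj_trans[OF step.IH]) auto
  qed
  have all: "reachable (with_proj ?G) (1, 1) p" if pV: "p \<in> pverts ?G" for p
  proof -
    obtain i j where p: "p = (i, j)" "i \<in> {1..2}" and j: "1 \<le> j" "j \<le> m"
      using pV V by (cases p) auto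
    from p have "i = 1 \<or> i = 2" by auto
    thus ?thesis
    proof
      assume "i = 2"
      have "((1, j), (2, j)) \<in> parcs ?G"
        using j by (auto simp: cartesian_product_def path_graph_def)
      from reachable_adj_trans[OF root[OF j] this] show ?thesis
        using p \<open>i = 2\<close> by simp
    qed (use p root[OF j] in simp)
  qed
  have sym: "symmetric (with_proj ?G)" by (rule sym_arcs)
  have "strongly_connected (with_proj ?G)"
  proof (rule strongly_connectedI)
    show "verts (with_proj ?G) \<noteq> {}" using assms V by auto
    show "reachable (with_proj ?G) u v"
      if "u \<in> verts (with_proj ?G)" "v \<in> verts (with_proj ?G)" for u v
    proof (rule reachable_trans)
      show "reachable (with_proj ?G) u (1, 1)"
        using that by (intro symmetric_reachable[OF sym all]) simp
      show "reachable (with_proj ?G) (1, 1) v"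
        using that by (intro all) simp
    qed
  qed
  thus ?thesis
    using reachable_mk_symmetric_eq[OF sym] by (simp add: connected_def strongly_connected_def)
qed

end

theory Submission
  imports Defs
begin

text \<open>
  The bound has two independent halves: the ladder has many arithmetical structures, and it has
  only finitely many, so that their cardinality is a meaningful number.

  Finiteness holds on every connected graph \<open>G\<close>. If \<open>(d, r)\<close> and \<open>(d', r')\<close> are structures with
  \<open>d \<le> d'\<close>, then symmetry of the adjacency matrix \<open>A\<close> gives
  \<open>\<Sum>v. d' v * r v * r' v = r\<^sup>T A r' = \<Sum>v. d v * r v * r' v\<close>, and as all entries are positive, \<open>d = d'\<close>.
  Hence the vectors \<open>d\<close> form an antichain of positive integer vectors, which is finite by
  Dickson's lemma (\<open>finite_antichain\<close>). Moreover \<open>d\<close> determines \<open>r\<close>: a positive vector in the kernel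
  of \<open>diag d - A\<close> is unique up to scaling, by connectedness, and primitivity fixes the scale.

  Many structures come from the path: if a positive vector \<open>r\<close> with \<open>r 1 = 1\<close> satisfies
  \<open>r i dvd r (i - 1) + r (i + 1)\<close> on \<open>{1..m}\<close>, with value \<open>0\<close> at both outer neighbours, then
  repeating \<open>r\<close> on the two rows of the ladder gives a structure there, as the additional neighbour of a vertex carries the same value as
  the vertex itself and raises the diagonal entry by one. Path vectors of length \<open>n + 1\<close> arise
  from those of length \<open>n\<close> by inserting the sum of two neighbouring entries between them; the new
  entry is a peak, that is, an entry with diagonal value one on the path. If each
  vector is built by inserting its rightmost peak last, no vector is built twice, and
  counting the vectors by the position of this peak yields the recurrence of the ballot numbers,
  whose diagonal consists of the Catalan numbers.
\<close>

section \<open>Antichains of integer vectors\<close>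

text \<open>
  The indices at which a sequence takes a value that it never undercuts later form an infinite
  set, and the sequence is monotone along them.
\<close>

lemma mono_subsequence:
  fixes s :: "nat \<Rightarrow> 'b::wellorder"
  shows "\<exists>g :: nat \<Rightarrow> nat. strict_mono g \<and> mono (s \<circ> g)"
proof -
  let ?P = "{k. \<forall>j\<ge>k. s k \<le> s j}"
  have "\<exists>k\<ge>N. k \<in> ?P" for N
  proof -
    define y where "y = (LEAST y. y \<in> s ` {N..})"
    have "y \<in> s ` {N..}"
      unfolding y_def by (rule LeastI[of _ "s N"]) simp
    then obtain k where "k \<ge> N" "y = s k" by auto
    moreover have "y \<le> s j" if "j \<ge> N" for j
      unfolding y_def using that by (intro Least_le) simp
    ultimately have "k \<ge> N" "k \<in> ?P" by auto
    thus ?thesis by blast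
  qed
  hence inf: "infinite ?P"
    by (simp only: infinite_nat_iff_unbounded_le) blast
  have "mono (s \<circ> enumerate ?P)"
    using enumerate_in_set[OF inf] strict_mono_enumerate[OF inf]
    by (auto intro!: monoI simp: strict_mono_less_eq)
  thus ?thesis using strict_mono_enumerate[OF inf] by blast
qed

lemma mono_subsequence_coordinates:
  fixes f :: "nat \<Rightarrow> 'a \<Rightarrow> 'b::wellorder"
  assumes "finite V"
  shows "\<exists>g :: nat \<Rightarrow> nat. strict_mono g \<and> (\<forall>v\<in>V. mono (\<lambda>k. f (g k) v))"
  using assms
proof (induction V)
  case empty
  show ?case by (intro exI[of _ id]) (simp add: strict_mono_def)
next
  case (insert w V)
  then obtain g :: "nat \<Rightarrow> nat" where g: "strict_mono g" "\<And>v. v \<in> V \<Longrightarrow> mono (\<lambda>k. f (g k) v)" by blast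
  obtain h :: "nat \<Rightarrow> nat" where h: "strict_mono h" "mono ((\<lambda>k. f (g k) w) \<circ> h)"
    using mono_subsequence by blast
  have "mono (\<lambda>k. f ((g \<circ> h) k) v)" if "v \<in> insert w V" for v
    using that h g(2)[of v]
    by (auto simp: o_def mono_def strict_mono_less_eq)
  thus ?case using strict_mono_o[OF g(1) h(1)] by blast
qed

text \<open>
  Dickson's lemma: along a subsequence that is monotone in every coordinate, any two members are
  comparable.
\<close>

lemma finite_antichain:
  fixes S :: "('a \<Rightarrow> int) set"
  assumes "finite V" and pos: "\<And>d v. d \<in> S \<Longrightarrow> v \<in> V \<Longrightarrow> 0 \<le> d v"
    and antichain: "\<And>d d'. d \<in> S \<Longrightarrow> d' \<in> S \<Longrightarrow> \<forall>v\<in>V. d v \<le> d' v \<Longrightarrow> d = d'"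
  shows "finite S"
proof (rule ccontr)
  assume "infinite S"
  then obtain f :: "nat \<Rightarrow> 'a \<Rightarrow> int" where f: "inj f" "range f \<subseteq> S"
    using infinite_countable_subset by blast
  obtain g :: "nat \<Rightarrow> nat" where g: "strict_mono g" "\<And>v. v \<in> V \<Longrightarrow> mono (\<lambda>k. nat (f (g k) v))"
    using mono_subsequence_coordinates[OF assms(1), of "\<lambda>k v. nat (f k v)"] by blast
  have "f (g 0) v \<le> f (g 1) v" if "v \<in> V" for v
  proof -
    have "0 \<le> f (g 1) v" using pos that f(2) by blast
    thus ?thesis using monoD[OF g(2)[OF that], of 0 1] by simp
  qed
  hence "f (g 0) = f (g 1)"
    using f(2) by (intro antichain) auto
  hence "g 0 = g 1" using f(1) by (simp add: inj_eq)
  thus False using strict_monoD[OF g(1), of 0 1] by simp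
qed

section \<open>Finitely many arithmetical structures\<close>

lemma diagonal_minus_adjacency:
  assumes "finite (pverts G)" "u \<in> pverts G"
  shows "(\<Sum>v\<in>pverts G. (diagonal_matrix d u v - adjacency_matrix G u v) * r v)
    = d u * r u - (\<Sum>v\<in>pverts G. adjacency_matrix G u v * r v)"
proof -
  have "(\<Sum>v\<in>pverts G. diagonal_matrix d u v * r v) = (\<Sum>v\<in>pverts G. if u = v then d u * r u else 0)"
    by (rule sum.cong) (auto simp: diagonal_matrix_def)
  thus ?thesis
    using assms by (simp add: left_diff_distrib sum_subtractf)
qed

lemma arithmetical_structure_eigen:
  assumes "arithmetical_structure G d r" "finite (pverts G)" "u \<in> pverts G"
  shows "d u * r u = (\<Sum>v\<in>pverts G. adjacency_matrix G u v * r v)"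
  using assms diagonal_minus_adjacency[of G u d r] unfolding arithmetical_structure_def by simp

lemma arithmetical_structure_pos:
  assumes "arithmetical_structure G d r" "u \<in> pverts G"
  shows "0 < d u" "0 < r u"
  using assms unfolding arithmetical_structure_def by (auto simp: PiE_iff)

lemma adjacency_matrix_symmetric:
  assumes "pair_graph G"
  shows "adjacency_matrix G u v = adjacency_matrix G v u"
proof -
  interpret pair_graph G by fact
  show ?thesis
    using sym_arcs by (auto simp: adjacency_matrix_def symmetric_def dest: symD)
qed

text \<open>
  Both \<open>\<Sum>v. d v * r v * r' v\<close> and \<open>\<Sum>v. d' v * r v * r' v\<close> are values of the bilinear form of the
  adjacency matrix at \<open>r\<close> and \<open>r'\<close>, which is symmetric.
\<close>

lemma arithmetical_structure_antichain:
  assumes G: "pair_graph G"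
    and A: "arithmetical_structure G d r" "arithmetical_structure G d' r'"
    and le: "\<forall>v\<in>pverts G. d v \<le> d' v"
  shows "d = d'"
proof -
  interpret pair_graph G by fact
  note fin = pair_finite_verts
  let ?V = "pverts G" and ?A = "adjacency_matrix G"
  have "(\<Sum>u\<in>?V. (d' u * r' u) * r u) = (\<Sum>u\<in>?V. \<Sum>v\<in>?V. ?A u v * r' v * r u)"
    using arithmetical_structure_eigen[OF A(2) fin] by (simp add: sum_distrib_right)
  also have "\<dots> = (\<Sum>v\<in>?V. \<Sum>u\<in>?V. ?A u v * r' v * r u)"
    by (rule sum.swap)
  also have "\<dots> = (\<Sum>v\<in>?V. (d v * r v) * r' v)"
    using arithmetical_structure_eigen[OF A(1) fin] adjacency_matrix_symmetric[OF G]
    by (simp add: sum_distrib_left mult_ac)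
  finally have "(\<Sum>v\<in>?V. (d' v - d v) * (r v * r' v)) = 0"
    by (simp add: algebra_simps sum_subtractf)
  moreover have "0 < r v * r' v" "0 \<le> (d' v - d v) * (r v * r' v)" if "v \<in> ?V" for v
    using le that arithmetical_structure_pos[OF A(1) that] arithmetical_structure_pos[OF A(2) that]
    by auto
  ultimately have "d v = d' v" if "v \<in> ?V" for v
    using that fin by (subst (asm) sum_nonneg_eq_0_iff) force+
  thus ?thesis
    using A unfolding arithmetical_structure_def by (intro PiE_ext[of d ?V _ d']) auto
qed

text \<open>
  A maximum principle: subtracting from \<open>r'\<close> the largest multiple of \<open>r\<close> that leaves a nonnegative
  vector produces a zero entry, and a zero entry of a nonnegative kernel vector of
  \<open>diag d - A\<close> forces zeros at all adjacent vertices, hence everywhere.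
\<close>

lemma arithmetical_structure_vector_unique:
  assumes G: "pair_graph G" "connected (with_proj G)"
    and A: "arithmetical_structure G d r" "arithmetical_structure G d r'"
  shows "r = r'"
proof -
  interpret pair_graph G by fact
  note fin = pair_finite_verts
  let ?V = "pverts G" and ?A = "adjacency_matrix G"
  note pos = arithmetical_structure_pos(2)[OF A(1)] arithmetical_structure_pos(2)[OF A(2)]
  have strong: "strongly_connected (with_proj G)"
    using G(2) reachable_mk_symmetric_eq[OF sym_arcs]
    by (simp add: connected_def strongly_connected_def)
  hence ne: "?V \<noteq> {}" by (simp add: strongly_connected_def)
  obtain z where z: "z \<in> ?V"
    and zmin: "\<And>v. v \<in> ?V \<Longrightarrow> real_of_int (r' z) / r z \<le> real_of_int (r' v) / r v"
    using ex_is_arg_min_if_finite[OF fin ne, of "\<lambda>v. real_of_int (r' v) / r v"]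
    by (auto simp: is_arg_min_linorder)
  \<comment> \<open>\<open>r' - (r' z / r z) * r\<close> with the denominator cleared; it vanishes at \<open>z\<close>.\<close>
  define w where "w v = r' v * r z - r v * r' z" for v
  have w_nonneg: "0 \<le> w v" if "v \<in> ?V" for v
  proof -
    have "real_of_int (r' z * r v) \<le> real_of_int (r' v * r z)"
      using zmin[OF that] pos[OF z] pos[OF that] by (simp add: field_simps)
    thus ?thesis unfolding w_def of_int_le_iff by (simp add: mult.commute)
  qed
  have w_eigen: "d u * w u = (\<Sum>v\<in>?V. ?A u v * w v)" if "u \<in> ?V" for u
  proof -
    have "d u * w u = (d u * r' u) * r z - (d u * r u) * r' z"
      by (simp add: w_def algebra_simps)
    also have "\<dots> = (\<Sum>v\<in>?V. ?A u v * w v)"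
      using that by (simp add: arithmetical_structure_eigen[OF A(1) fin]
        arithmetical_structure_eigen[OF A(2) fin] w_def sum_distrib_left sum_subtractf
        right_diff_distrib mult_ac)
    finally show ?thesis .
  qed
  have "w v = 0" if "v \<in> ?V" for v
  proof -
    have "reachable (with_proj G) z v"
      using strong z that by (auto simp: strongly_connected_def)
    thus ?thesis
    proof (induction rule: reachable_induct)
      case base
      show ?case by (simp add: w_def)
    next
      case (step x y)
      have arc: "(x, y) \<in> parcs G" using step(2) by simp
      hence xy: "x \<in> ?V" "y \<in> ?V" using arc by (auto dest: in_arcsD1 in_arcsD2)
      have "(\<Sum>v\<in>?V. ?A x v * w v) = 0" using w_eigen[OF xy(1)] step by simp
      moreover have "\<forall>v\<in>?V. 0 \<le> ?A x v * w v" using w_nonneg by (simp add: adjacency_matrix_def)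
      ultimately have "?A x y * w y = 0"
        using fin xy(2) by (simp add: sum_nonneg_eq_0_iff)
      thus ?case using arc by (simp add: adjacency_matrix_def)
    qed
  qed
  hence proportional: "r z * r' v = r' z * r v" if "v \<in> ?V" for v
    using that by (simp add: w_def mult.commute)
  have "normalize (r z * Gcd (r' ` ?V)) = normalize (r' z * Gcd (r ` ?V))"
  proof -
    have "(*) (r z) ` (r' ` ?V) = (*) (r' z) ` (r ` ?V)"
      using proportional by (auto simp: image_image intro!: image_cong)
    thus ?thesis by (metis Gcd_mult)
  qed
  hence "r z = r' z"
    using A pos[OF z] unfolding arithmetical_structure_def by simp
  hence "r v = r' v" if "v \<in> ?V" for v
    using proportional[OF that] pos[OF z] by simp
  thus ?thesis
    using A unfolding arithmetical_structure_def by (intro PiE_ext[of r ?V _ r']) auto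
qed

theorem finite_arithmetical_structures:
  assumes G: "pair_graph G" "connected (with_proj G)"
  shows "finite (arithmetical_structures G)"
proof -
  interpret pair_graph G by fact
  have "finite (fst ` arithmetical_structures G)"
  proof (rule finite_antichain[OF pair_finite_verts])
    show "0 \<le> d v" if "d \<in> fst ` arithmetical_structures G" "v \<in> pverts G" for d v
      using that by (auto simp: arithmetical_structures_def
        dest: arithmetical_structure_pos(1) intro: less_imp_le)
  qed (auto simp: arithmetical_structures_def intro: arithmetical_structure_antichain[OF G(1)])
  moreover have "inj_on fst (arithmetical_structures G)"
    by (auto simp: inj_on_def arithmetical_structures_def
      intro: arithmetical_structure_vector_unique[OF G])
  ultimately show ?thesis by (rule finite_imageD)
qed

section \<open>Vectors on paths, counted by their last peak\<close>

text \<open>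
  Vectors on the path with vertices \<open>{1..n}\<close>, continued by zero, so that the two end vertices obey
  the same divisibility condition as the others. Vertex \<open>i\<close> is a peak if it equals the sum of its
  neighbours; all peaks lie in \<open>{1..q}\<close>. The entry \<open>r 1 = 1\<close> expresses primitivity, as the
  divisibility conditions make \<open>r 1\<close> divide every entry.
\<close>

definition path_vectors :: "nat \<Rightarrow> nat \<Rightarrow> (nat \<Rightarrow> int) set" where
  "path_vectors n q = {r. (\<forall>i\<in>{1..n}. 0 < r i) \<and> (\<forall>i. i \<notin> {1..n} \<longrightarrow> r i = 0) \<and> r 1 = 1 \<and>
     (\<forall>i\<in>{1..n}. r i dvd r (i - 1) + r (i + 1)) \<and>
     (\<forall>i\<in>{1..n}. r i = r (i - 1) + r (i + 1) \<longrightarrow> i \<le> q)}"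

definition insert_peak :: "nat \<Rightarrow> (nat \<Rightarrow> int) \<Rightarrow> nat \<Rightarrow> int" where
  "insert_peak q r i = (if i < q then r i else if i = q then r (q - 1) + r q else r (i - 1))"

text \<open>
  Deleting the entry at position \<open>q\<close> undoes the insertion.
\<close>

lemma inj_insert_peak: "inj (insert_peak q)"
proof (rule injI, rule ext)
  fix r s i assume "insert_peak q r = insert_peak q s"
  from fun_cong[OF this, of "if i < q then i else i + 1"] show "r i = s i"
    by (simp add: insert_peak_def split: if_splits)
qed

text \<open>
  The insertion changes the neighbour sums of only the two entries next to the new one, and raises
  each by the entry itself, so divisibility persists. The right one, now at \<open>q + 1\<close>, is no longer
  a peak because \<open>r (q - 1)\<close> is positive; hence a peak of \<open>r\<close> at \<open>q\<close> is allowed. For \<open>q = n + 1\<close> the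
  right neighbour is the outer zero and the path is prolonged at its end. At \<open>q = 1\<close> the claim
  fails: the vector \<open>1\<close> would become \<open>1, 1\<close>, whose second entry is a peak as well.
\<close>

lemma insert_peak_path_vectors:
  assumes r: "r \<in> path_vectors n q" and q: "2 \<le> q" "q \<le> n + 1"
  shows "insert_peak q r \<in> path_vectors (n + 1) q - path_vectors (n + 1) (q - 1)"
proof -
  let ?s = "insert_peak q r"
  have pos: "0 < r i" if "1 \<le> i" "i \<le> n" for i
    using r that unfolding path_vectors_def by auto
  have zero: "r i = 0" if "i = 0 \<or> n < i" for i
    using r that unfolding path_vectors_def by auto
  have dvd: "r i dvd r (i - 1) + r (i + 1)" if "1 \<le> i" "i \<le> n" for i
    using r that unfolding path_vectors_def by auto
  have peak: "i \<le> q" if "1 \<le> i" "i \<le> n" "r i = r (i - 1) + r (i + 1)" for i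
    using r that unfolding path_vectors_def by auto
  have nonneg: "0 \<le> r i" for i
    using pos[of i] zero[of i] by (cases "1 \<le> i \<and> i \<le> n") auto
  have "0 < r (q - 1) + r q"
    using pos[of "q - 1"] nonneg[of q] q by (intro add_pos_nonneg) auto
  hence s_pos: "(i \<in> {1..n + 1} \<longrightarrow> 0 < ?s i) \<and> (i \<notin> {1..n + 1} \<longrightarrow> ?s i = 0)" for i
    using q pos[of i] pos[of "i - 1"] zero[of i] zero[of "i - 1"]
    by (auto simp: insert_peak_def)
  have s_dvd: "?s i dvd ?s (i - 1) + ?s (i + 1)" if i: "1 \<le> i" "i \<le> n + 1" for i
  proof -
    consider "i + 1 < q" | "i + 1 = q" | "i = q" | "i = q + 1" | "q + 1 < i" by linarith
    thus ?thesis
    proof cases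
      case 1
      thus ?thesis using dvd[of i] i q by (auto simp: insert_peak_def)
    next
      case 2
      have "r i dvd (r (i - 1) + r (i + 1)) + r i"
        using dvd[of i] i 2 q by simp
      thus ?thesis using i by (simp add: insert_peak_def add_ac flip: 2)
    next
      case 3
      thus ?thesis using q by (simp add: insert_peak_def)
    next
      case 4
      have "r q dvd (r (q - 1) + r (q + 1)) + r q"
        using dvd[of q] i 4 q by simp
      thus ?thesis using 4 by (simp add: insert_peak_def add_ac)
    next
      case 5
      thus ?thesis using dvd[of "i - 1"] i q by (auto simp: insert_peak_def)
    qed
  qed
  have s_peak: "i \<le> q" if i: "1 \<le> i" "i \<le> n + 1" and eq: "?s i = ?s (i - 1) + ?s (i + 1)" for i
  proof (rule ccontr)
    assume "\<not> i \<le> q"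
    then consider "i = q + 1" | "q + 1 < i" by linarith
    thus False
    proof cases
      case 1
      moreover have "0 < r (q - 1)" using q by (intro pos) auto
      ultimately show ?thesis using eq nonneg[of "q + 1"] by (simp add: insert_peak_def)
    next
      case 2
      hence "\<not> i - 1 < q" "i - 1 \<noteq> q" "1 \<le> i - 1" "i - 1 \<le> n" using i by auto
      thus ?thesis using 2 eq peak[of "i - 1"] by (simp add: insert_peak_def)
    qed
  qed
  have "?s 1 = 1"
    using r q unfolding path_vectors_def insert_peak_def by auto
  hence "?s \<in> path_vectors (n + 1) q"
    using s_pos s_dvd s_peak unfolding path_vectors_def by auto
  moreover have "?s \<notin> path_vectors (n + 1) (q - 1)"
  proof
    assume "?s \<in> path_vectors (n + 1) (q - 1)"
    moreover have "?s q = ?s (q - 1) + ?s (q + 1)" using q by (simp add: insert_peak_def)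
    ultimately have "q \<le> q - 1" using q unfolding path_vectors_def by auto
    thus False using q by simp
  qed
  ultimately show ?thesis by blast
qed

lemma path_vectors_mono: "q \<le> q' \<Longrightarrow> path_vectors n q \<subseteq> path_vectors n q'"
  unfolding path_vectors_def by fastforce

text \<open>
  On the right, the vectors without a peak at \<open>q\<close> account for the first summand and those obtained
  by inserting one there for the second.
\<close>

lemma card_path_vectors_recurrence:
  assumes fin: "finite (path_vectors (n + 1) q)" and q: "2 \<le> q" "q \<le> n + 1"
  shows "card (path_vectors (n + 1) (q - 1)) + card (path_vectors n q)
    \<le> card (path_vectors (n + 1) q)"
proof -
  have sub: "path_vectors (n + 1) (q - 1) \<subseteq> path_vectors (n + 1) q"
    by (rule path_vectors_mono) simp
  have "card (path_vectors n q) \<le> card (path_vectors (n + 1) q - path_vectors (n + 1) (q - 1))"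
    using insert_peak_path_vectors[OF _ q] fin
    by (intro card_inj_on_le[OF inj_on_subset[OF inj_insert_peak[of q]]]) auto
  also have "\<dots> = card (path_vectors (n + 1) q) - card (path_vectors (n + 1) (q - 1))"
    using fin sub by (intro card_Diff_subset) (auto intro: finite_subset)
  finally show ?thesis using card_mono[OF fin sub] by linarith
qed

section \<open>Ballot numbers\<close>

text \<open>
  The number of lattice paths from \<open>(0, 0)\<close> to \<open>(a, c)\<close> that stay weakly below the diagonal, for
  \<open>c \<le> a\<close>, as the reflection principle gives it.
\<close>

definition ballot :: "nat \<Rightarrow> nat \<Rightarrow> int" where
  "ballot a c = int ((a + c) choose a) - int ((a + c) choose (a + 1))"

lemma ballot_0_right: "ballot a 0 = 1"
  by (simp add: ballot_def)

lemma ballot_Suc_Suc: "ballot (Suc a) (Suc c) = ballot (Suc a) c + ballot a (Suc c)"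
  by (simp add: ballot_def)

text \<open>
  The zero just above the diagonal makes \<open>ballot_Suc_Suc\<close> the ballot recurrence up to and including
  the diagonal.
\<close>

lemma ballot_Suc_diagonal: "ballot a (Suc a) = 0"
  using binomial_symmetric[of a "a + Suc a"] by (simp add: ballot_def)

lemma catalan_eq_ballot: "int (catalan n) = ballot n n"
proof -
  have "(n + 1) * ((2 * n) choose (n + 1)) = n * ((2 * n) choose n)"
    by (cases n) (use Suc_times_binomial_add[of n "n - 1"] in \<open>simp_all add: mult_2\<close>)
  hence "int (n + 1) * int ((2 * n) choose (n + 1)) = int n * int ((2 * n) choose n)"
    by (simp only: flip: of_nat_mult)
  hence "int ((2 * n) choose n) = int (n + 1) * ballot n n"
    unfolding ballot_def mult_2 by (simp add: algebra_simps)
  thus ?thesis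
    unfolding catalan_def by (simp add: zdiv_int)
qed

text \<open>
  The shift in \<open>path_vectors (a + 1) (c + 2)\<close> comes from the smallest position \<open>2\<close> at which a peak
  can be inserted into the single path vector of length \<open>1\<close>. At \<open>c = a\<close> the bound \<open>c + 2\<close> exceeds the
  length, so all path vectors are counted.
\<close>

lemma ballot_le_card_path_vectors:
  assumes fin: "\<And>n q. finite (path_vectors (n + 1) q)" and "c \<le> a"
  shows "ballot a c \<le> int (card (path_vectors (a + 1) (c + 2)))"
  using \<open>c \<le> a\<close>
proof (induction a arbitrary: c)
  case 0
  have "(\<lambda>i. if i = 1 then 1 else 0) \<in> path_vectors (0 + 1) (0 + 2)"
    by (auto simp: path_vectors_def)
  hence "1 \<le> card (path_vectors (0 + 1) (0 + 2))"
    using fin[of 0 2] by (metis Suc_leI One_nat_def card_gt_0_iff empty_iff add_0)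
  thus ?case using 0 by (simp add: ballot_0_right)
next
  case (Suc a)
  note IH = Suc.IH and rec = card_path_vectors_recurrence[OF fin, where n = "a + 1"]
  have below: "ballot (Suc a) c \<le> int (card (path_vectors (Suc a + 1) (c + 2)))" if "c \<le> a" for c
    using that
  proof (induction c)
    case 0
    thus ?case using rec[of 2] IH[of 0] by (simp add: ballot_0_right numeral_2_eq_2)
  next
    case (Suc c)
    thus ?case using rec[of "c + 3"] IH[of "Suc c"]
      by (simp add: ballot_Suc_Suc numeral_3_eq_3)
  qed
  show ?case
  proof (cases "c \<le> a")
    case False
    hence c: "c = Suc a" using Suc.prems by simp
    have "ballot (Suc a) c = ballot (Suc a) a"
      by (simp add: c ballot_Suc_Suc ballot_Suc_diagonal)
    also have "\<dots> \<le> int (card (path_vectors (Suc a + 1) (a + 2)))"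
      by (rule below) simp
    also have "\<dots> \<le> int (card (path_vectors (Suc a + 1) (c + 2)))"
      using card_mono[OF fin path_vectors_mono, of "a + 2" "c + 2" "Suc a"] c by simp
    finally show ?thesis .
  qed (rule below)
qed

section \<open>From the path to the ladder\<close>

text \<open>
  The summand \<open>1\<close> is due to the neighbour in the other row, which carries the same entry.
\<close>

definition ladder_structure ::
    "nat \<Rightarrow> (nat \<Rightarrow> int) \<Rightarrow> (nat \<times> nat \<Rightarrow> int) \<times> (nat \<times> nat \<Rightarrow> int)" where
  "ladder_structure m r =
    (restrict (\<lambda>(i, j). (r (j - 1) + r (j + 1)) div r j + 1) ({1..2} \<times> {1..m}),
     restrict (\<lambda>(i, j). r j) ({1..2} \<times> {1..m}))"

lemma pverts_path_graph: "pverts (path_graph n) = {1..n}"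
  by (simp add: path_graph_def)

lemma parcs_path_graph:
  "(i, j) \<in> parcs (path_graph n) \<longleftrightarrow> i \<in> {1..n} \<and> j \<in> {1..n} \<and> (j = i + 1 \<or> i = j + 1)"
  by (auto simp: path_graph_def)

lemma ladder_structure_arithmetical:
  assumes r: "r \<in> path_vectors m q" and m: "1 \<le> m"
  shows "ladder_structure m r \<in> arithmetical_structures (path_graph 2 \<box> path_graph m)"
proof -
  let ?G = "path_graph 2 \<box> path_graph m"
  have V: "pverts ?G = {1..2} \<times> {1..m}"
    by (simp add: cartesian_product_def path_graph_def)
  have pos: "0 < r i" if "1 \<le> i" "i \<le> m" for i
    using r that unfolding path_vectors_def by auto
  have zero: "r i = 0" if "i = 0 \<or> m < i" for i
    using r that unfolding path_vectors_def by auto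
  have nonneg: "0 \<le> r i" for i
    using pos[of i] zero[of i] by (cases "1 \<le> i \<and> i \<le> m") auto
  have dvd: "r i dvd r (i - 1) + r (i + 1)" if "1 \<le> i" "i \<le> m" for i
    using r that unfolding path_vectors_def by auto
  have r1: "r 1 = 1" using r unfolding path_vectors_def by auto
  obtain d s where ds: "ladder_structure m r = (d, s)" by fastforce
  have d: "d (i, j) = (r (j - 1) + r (j + 1)) div r j + 1" and s: "s (i, j) = r j"
    if "i \<in> {1..2}" "j \<in> {1..m}" for i j
    using ds that by (auto simp: ladder_structure_def)
  have ext: "d \<in> extensional (pverts ?G)" "s \<in> extensional (pverts ?G)"
    using ds V by (auto simp: ladder_structure_def)
  have "0 < d p" "0 < s p" if "p \<in> pverts ?G" for p
    using that V by (auto simp: d s pos nonneg pos_imp_zdiv_nonneg_iff intro!: add_nonneg_pos)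
  hence PiE: "d \<in> pverts ?G \<rightarrow>\<^sub>E {0<..}" "s \<in> pverts ?G \<rightarrow>\<^sub>E {0<..}"
    using ext by (auto simp: PiE_iff)
  have "s (1, 1) = 1" using m r1 by (simp add: s)
  moreover have "(1, 1) \<in> pverts ?G" using m V by simp
  ultimately have "Gcd (s ` pverts ?G) dvd 1" by (metis Gcd_dvd imageI)
  hence gcd: "Gcd (s ` pverts ?G) = 1" by simp
  have "d u * s u - (\<Sum>v\<in>pverts ?G. adjacency_matrix ?G u v * s v) = 0" if u: "u \<in> pverts ?G" for u
  proof -
    obtain i j where ij: "u = (i, j)" "i \<in> {1..2}" "j \<in> {1..m}" using u V by (cases u) auto
    hence i: "i = 1 \<or> i = 2" by auto
    let ?N = "{v \<in> pverts ?G. (u, v) \<in> parcs ?G}"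
    \<comment> \<open>The row other than \<open>i\<close> is \<open>3 - i\<close>; the vector is zero at those of the three points that lie
      off the ladder.\<close>
    let ?E = "{(3 - i, j), (i, j - 1), (i, j + 1)}"
    have "(\<Sum>v\<in>pverts ?G. adjacency_matrix ?G u v * s v) = (\<Sum>v\<in>?N. s v)"
      using V by (intro sum.mono_neutral_cong_right) (auto simp: adjacency_matrix_def)
    also have "\<dots> = (\<Sum>v\<in>?N. r (snd v))"
      using V s by (intro sum.cong) auto
    also have "\<dots> = (\<Sum>v\<in>?E. r (snd v))"
    proof (rule sum.mono_neutral_left)
      show "?N \<subseteq> ?E"
        unfolding ij by (auto simp: cartesian_product_def parcs_path_graph)
      show "\<forall>v\<in>?E - ?N. r (snd v) = 0"
        using ij(2,3) i unfolding ij(1)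
        by (auto simp: cartesian_product_def parcs_path_graph pverts_path_graph intro!: zero)
    qed simp
    also have "\<dots> = r j + (r (j - 1) + r (j + 1))"
      using ij i by auto
    also have "\<dots> = d u * s u"
      using ij dvd[of j] by (simp add: d s distrib_right)
    finally show ?thesis by simp
  qed
  moreover have "finite (pverts ?G)" using V by simp
  ultimately have "arithmetical_structure ?G d s"
    unfolding arithmetical_structure_def using PiE gcd
    by (simp add: diagonal_minus_adjacency)
  thus ?thesis by (simp add: ds arithmetical_structures_def)
qed

lemma inj_on_ladder_structure: "inj_on (ladder_structure m) (path_vectors m q)"
proof (rule inj_onI, rule ext)
  fix r s i
  assume rs: "r \<in> path_vectors m q" "s \<in> path_vectors m q"
    and eq: "ladder_structure m r = ladder_structure m s"
  show "r i = s i"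
  proof (cases "i \<in> {1..m}")
    case True
    thus ?thesis
      using fun_cong[OF arg_cong[OF eq, of snd], of "(1, i)"] by (simp add: ladder_structure_def)
  next
    case False
    thus ?thesis using rs unfolding path_vectors_def by auto
  qed
qed

theorem theorem3p17:
  fixes m :: nat
  assumes "m \<ge> 1"
  shows "catalan (m - 1) \<le> card (arithmetical_structures (path_graph 2 \<box> path_graph m))"
proof -
  have finite_ladder: "finite (arithmetical_structures (path_graph 2 \<box> path_graph n))"
    if "1 \<le> n" for n
    by (intro finite_arithmetical_structures pair_graph_cartesian_product pair_graph_path_graph
      connected_ladder that)
  have image: "ladder_structure n ` path_vectors n q
      \<subseteq> arithmetical_structures (path_graph 2 \<box> path_graph n)" if "1 \<le> n" for n q
    using ladder_structure_arithmetical that by blast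
  have "finite (path_vectors (n + 1) q)" for n q
    by (rule inj_on_finite[OF inj_on_ladder_structure image finite_ladder]) simp_all
  hence "ballot (m - 1) (m - 1) \<le> int (card (path_vectors (m - 1 + 1) (m - 1 + 2)))"
    by (intro ballot_le_card_path_vectors) simp_all
  hence "catalan (m - 1) \<le> card (path_vectors m (m + 1))"
    using assms by (simp flip: catalan_eq_ballot)
  also have "\<dots> \<le> card (arithmetical_structures (path_graph 2 \<box> path_graph m))"
    by (rule card_inj_on_le[OF inj_on_ladder_structure image[OF assms] finite_ladder[OF assms]])
  finally show ?thesis .
qed

end
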